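(* Let $\lambda_1,\dots,\lambda_n>0$, $\mu_1>\cdots>\mu_n>0$ and $v_1,\dots,v_n$ be given, and suppose that for all $i,j$: if $\mathbb E[S_i]\ge\mathbb E[S_j]$ then $\frac{\mathbb E[S_i^2]}{\mathbb E[S_i]}\ge\frac{\mathbb E[S_j^2]}{\mathbb E[S_j]}$ (equivalently, $v_i\mu_i\ge v_j\mu_j$ whenever $1/\mu_i\ge 1/\mu_j$). For any optimal solution $(\boldsymbol x^*,\alpha^* )$ of the queue partition problem $$(\mathrm{QPP})\qquad\inf_{\boldsymbol x,\alpha}\ f(\boldsymbol x,\alpha)\quad\text{s.t. }(\boldsymbol x,\alpha)\in\mathcal F,\ 0\le\alpha\le1,\ x_i\in[0,1],\ i=1,\dots,n,$$ there exists $i^*\in\{0,1,\dots,n\}$ such that either $$x_i^*=\begin{cases}1&\text{if }i\le i^*\\0&\text{if }i>i^*\end{cases}\ \text{ for all }i,\qquad\text{or}\qquad x_i^*=\begin{cases}0&\text{if }i\le i^*\\1&\text{if }i>i^*\end{cases}\ \text{ for all }i.$$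
   Context: There are $n$ customer types; type $i$ arrives as a Poisson process with rate $\lambda_i$ and has a service time $S_i$ (nonnegative random variable, under a unit-capacity server) with $\mathbb E[S_i]=1/\mu_i$ and $\mathbb E[S_i^2]=v_i<\infty$. Unit capacity is split into two queues with capacities $\alpha$ and $1-\alpha$; $x_i$ is the probability that a type $i$ customer is assigned to the first queue. The expected waiting time is, for $0<\alpha<1$, $$f(\boldsymbol x,\alpha)=\frac{\sum_i\lambda_ix_iv_i}{\alpha^2-\alpha\sum_i\frac{\lambda_ix_i}{\mu_i}}\cdot\frac{\sum_ix_i\lambda_i}{2\sum_i\lambda_i}+\frac{\sum_i\lambda_i(1-x_i)v_i}{(1-\alpha)^2-(1-\alpha)\sum_i\frac{\lambda_i(1-x_i)}{\mu_i}}\cdot\frac{\sum_i(1-x_i)\lambda_i}{2\sum_i\lambda_i},$$ and $f(\boldsymbol 0,0)=f(\boldsymbol 1,1)=\tfrac12\left(\sum_i\lambda_iv_i\right)/\left(1-\sum_i\lambda_i/\mu_i\right)$. The feasible set $\mathcal F$ consists of the pairs $(\boldsymbol x,\alpha)$ with $0<\alpha<1$ and $\sum_i\frac{\lambda_ix_i}{\mu_i}<\alpha<\sum_i\frac{\lambda_ix_i}{\mu_i}+1-\sum_i\frac{\lambda_i}{\mu_i}$, together with $(\boldsymbol 0,0)$ and $(\boldsymbol 1,1)$ (where $\sum_i\lambda_i/\mu_i<1$). *)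

theory Defs
  imports "HOL-Probability.Probability"
begin

text \<open>
  Customer types are indexed by \<open>{1..n}\<close>. A solution is a pair \<open>(x, a)\<close> of an assignment
  \<open>x :: nat \<Rightarrow> real\<close>, of which only the values on \<open>{1..n}\<close> matter, and a capacity \<open>a\<close> of the
  first queue. Accordingly, the vectors \<open>0\<close> and \<open>1\<close> mean any \<open>x\<close> that is constantly \<open>0\<close>
  (resp. \<open>1\<close>) on \<open>{1..n}\<close>.
\<close>

text \<open>
  The case \<open>a \<notin> {0<..<1}\<close> is the value of a single queue of unit capacity. In the feasible set
  below this case occurs only at the points \<open>(0, 0)\<close> and \<open>(1, 1)\<close>.
\<close>

definition waiting_time ::
  "nat \<Rightarrow> (nat \<Rightarrow> real) \<Rightarrow> (nat \<Rightarrow> real) \<Rightarrow> (nat \<Rightarrow> real) \<Rightarrow> (nat \<Rightarrow> real) \<times> real \<Rightarrow> real" where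
  "waiting_time n lam mu v = (\<lambda>(x, a).
     if 0 < a \<and> a < 1 then
       (\<Sum>i=1..n. lam i * x i * v i) / (a\<^sup>2 - a * (\<Sum>i=1..n. lam i * x i / mu i))
         * ((\<Sum>i=1..n. x i * lam i) / (2 * (\<Sum>i=1..n. lam i)))
       + (\<Sum>i=1..n. lam i * (1 - x i) * v i)
           / ((1 - a)\<^sup>2 - (1 - a) * (\<Sum>i=1..n. lam i * (1 - x i) / mu i))
         * ((\<Sum>i=1..n. (1 - x i) * lam i) / (2 * (\<Sum>i=1..n. lam i)))
     else
       1 / 2 * ((\<Sum>i=1..n. lam i * v i) / (1 - (\<Sum>i=1..n. lam i / mu i))))"

definition stable_set ::
  "nat \<Rightarrow> (nat \<Rightarrow> real) \<Rightarrow> (nat \<Rightarrow> real) \<Rightarrow> ((nat \<Rightarrow> real) \<times> real) set" where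
  "stable_set n lam mu =
     {(x, a). 0 < a \<and> a < 1
        \<and> (\<Sum>i=1..n. lam i * x i / mu i) < a
        \<and> a < (\<Sum>i=1..n. lam i * x i / mu i) + 1 - (\<Sum>i=1..n. lam i / mu i)}
     \<union> {(x, a). (\<forall>i\<in>{1..n}. x i = 0) \<and> a = 0}
     \<union> {(x, a). (\<forall>i\<in>{1..n}. x i = 1) \<and> a = 1}"

definition qpp_feasible ::
  "nat \<Rightarrow> (nat \<Rightarrow> real) \<Rightarrow> (nat \<Rightarrow> real) \<Rightarrow> (nat \<Rightarrow> real) \<times> real \<Rightarrow> bool" where
  "qpp_feasible n lam mu = (\<lambda>(x, a).
     (x, a) \<in> stable_set n lam mu \<and> 0 \<le> a \<and> a \<le> 1 \<and> (\<forall>i\<in>{1..n}. 0 \<le> x i \<and> x i \<le> 1))"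

definition qpp_optimal ::
  "nat \<Rightarrow> (nat \<Rightarrow> real) \<Rightarrow> (nat \<Rightarrow> real) \<Rightarrow> (nat \<Rightarrow> real) \<Rightarrow> (nat \<Rightarrow> real) \<times> real \<Rightarrow> bool" where
  "qpp_optimal n lam mu v = is_arg_min (waiting_time n lam mu v) (qpp_feasible n lam mu)"

end

theory Submission
  imports Defs
begin

text \<open>
  At an interior optimum, the derivative of the objective in the load of type \<open>i\<close>, with both
  slacks fixed, has the form \<open>P * mu i + Q * (v i * mu i) - K\<close>, and a type is split only where it
  vanishes. Since \<open>mu\<close> decreases while \<open>v * mu\<close> increases, \<open>P\<close> and \<open>Q\<close> of opposite signs make
  this derivative strictly monotone in \<open>i\<close>, which gives a threshold. The same sign of \<open>P\<close>
  and \<open>Q\<close> contradicts stationarity in the slack combined with the averages of the derivative over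
  both queues; \<open>P = Q = 0\<close> forces an exact half split, which costs twice as much as a single queue.
  Finally a split type at the threshold is excluded by changing its load and the slack in the
  proportion for which the first-order terms of both queues vanish separately: each of the two
  ratios then can only decrease.
\<close>

section \<open>Calculus and inequalities for real numbers\<close>

lemma ratio_derivative:
  fixes A C D E p q g h :: real
  assumes "A > 0" "C > 0" "D > 0" "E > 0"
  shows "((\<lambda>t. (A + t * p) * (C + t * q) / ((D + t * g) * (E + t * h)))
    has_real_derivative A * C / (D * E) * (p / A + q / C - g / D - h / E)) (at 0)"
  using assms by (auto intro!: derivative_eq_intros simp: field_simps)

text \<open>One-sided, because a type with \<open>x i = 0\<close> can only gain load in the first
  queue.\<close>

lemma derivative_nonneg_at_right_min:
  fixes F :: "real \<Rightarrow> real"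
  assumes "(F has_real_derivative L) (at 0)" "0 < e"
    and "\<And>t. 0 < t \<Longrightarrow> t < e \<Longrightarrow> F 0 \<le> F t"
  shows "L \<ge> 0"
proof (rule ccontr)
  assume "\<not> L \<ge> 0"
  then obtain b where b: "b > 0" "\<And>h. 0 < h \<Longrightarrow> h < b \<Longrightarrow> F (0 + h) < F 0"
    using DERIV_neg_dec_right[OF assms(1)] by auto
  have "F (0 + min b e / 2) < F 0" "F 0 \<le> F (min b e / 2)"
    using b assms by auto
  then show False by simp
qed

text \<open>Scale-free core of the next lemma. The bound \<open>s + t \<le> 1 + s * t\<close>
  reduces \<open>first\<close> and \<open>second\<close> to inequalities in the product
  \<open>p\<close>; eliminating \<open>a'\<close> by \<open>stat\<close> gives
  \<open>1 + a - p * \<delta> \<le> p * \<delta> * (a * p)\<close>, which fails because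
  \<open>p * \<delta> < 1\<close> and \<open>p \<le> 1\<close>.\<close>

lemma log_gradients_same_sign_impossible:
  fixes s t \<delta> a a' :: real
  assumes "s > 0" "t > 0" "s \<le> 1" "t \<le> 1" "s + t < 2" "\<delta> > 0" "a > 1" "a' > \<delta>"
    and stat: "1 + a = s * t * (\<delta> + a')"
    and first: "2 - s - t \<le> (1 - s * t * \<delta>) * (1 - 1 / a)"
    and second: "s + t - 2 * (s * t) \<ge> (1 / \<delta> - s * t) * (1 - \<delta> / a')"
  shows False
proof -
  define p where "p = s * t"
  have p: "p > 0" "p \<le> 1" using assms by (auto simp: p_def mult_le_one)
  have sum_le: "s + t \<le> 1 + p"
    using mult_nonneg_nonneg[of "1 - s" "1 - t"] assms by (simp add: p_def algebra_simps)
  have ia: "0 < 1 - 1 / a" using assms by simp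
  have "0 < (1 - p * \<delta>) * (1 - 1 / a)" using first assms by (simp add: p_def)
  then have pd: "p * \<delta> < 1" using ia by (simp add: zero_less_mult_iff)
  have "1 - p \<le> (1 - p * \<delta>) * (1 - 1 / a)" using first sum_le by (simp add: p_def)
  then have "(1 - p) * a \<le> (1 - p * \<delta>) * (a - 1)"
    using assms by (simp add: field_simps)
  then have 1: "1 - p * \<delta> \<le> a * p * (1 - \<delta>)" by (simp add: algebra_simps)
  with pd have d1: "\<delta> < 1"
    using assms p by (smt (verit) mult_pos_pos zero_less_mult_iff)
  have "(1 / \<delta> - p) * (1 - \<delta> / a') \<le> 1 - p" using second sum_le by (simp add: p_def)
  then have "(1 - p * \<delta>) * (a' - \<delta>) \<le> (1 - p) * \<delta> * a'"
    using assms by (simp add: field_simps)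
  then have "(1 - \<delta>) * a' \<le> \<delta> * (1 - p * \<delta>)" by (simp add: algebra_simps)
  then have "p * ((1 - \<delta>) * a') \<le> p * (\<delta> * (1 - p * \<delta>))"
    using p by simp
  moreover have "p * a' = 1 + a - p * \<delta>" using stat by (simp add: p_def algebra_simps)
  ultimately have "(1 - \<delta>) * (1 + a - p * \<delta>) \<le> p * \<delta> * (1 - p * \<delta>)"
    by (metis mult.assoc mult.left_commute)
  also have "\<dots> \<le> p * \<delta> * (a * p * (1 - \<delta>))" using 1 p assms by simp
  finally have "(1 - \<delta>) * (1 + a - p * \<delta>) \<le> (1 - \<delta>) * (p * \<delta> * (a * p))"
    by (simp add: mult_ac)
  then have "1 + a - p * \<delta> \<le> p * \<delta> * (a * p)" using d1 by simp
  moreover have "p * \<delta> * (a * p) \<le> 1 * (a * 1)"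
    using pd p assms by (intro mult_mono) auto
  ultimately show False using pd by simp
qed

text \<open>Normalisation by the unprimed queue: \<open>s\<close> and \<open>t\<close> are the
  ratios of the partial derivatives in the numerator factors, and denominators are measured in units
  of \<open>D\<close>. Dividing \<open>first\<close> by \<open>f\<close>, and \<open>second\<close>
  by \<open>g / (s * t)\<close>, makes both scale-free.\<close>

lemma gradients_same_sign_impossible:
  fixes A C D E A' C' D' E' f g :: real
  assumes pos: "A > 0" "C > 0" "D > 0" "A' > 0" "C' > 0" "D' > 0" "D < E" "D' < E'"
    and f: "f = A * C / (D * E)" and g: "g = A' * C' / (D' * E')"
    and stat: "f * (1 / D + 1 / E) = g * (1 / D' + 1 / E')"
    and P: "f / A \<ge> g / A'" and Q: "f / C \<ge> g / C'"
    and ne: "f / A \<noteq> g / A' \<or> f / C \<noteq> g / C'"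
    and first: "(f / A - g / A') * A + (f / C - g / C') * C \<le> (f / E - g / E') * (E - D)"
    and second: "(f / A - g / A') * A' + (f / C - g / C') * C' \<ge> (f / E - g / E') * (E' - D')"
  shows False
proof -
  have E: "E > 0" "E' > 0" using pos by auto
  have fg: "f > 0" "g > 0" using pos E by (auto simp: f g)
  define s where "s = A * g / (A' * f)"
  define t where "t = C * g / (C' * f)"
  define \<delta> where "\<delta> = D' / D"
  have st: "s * t = g * D * E / (f * D' * E')"
    using pos E fg by (simp add: s_def t_def f g field_simps)
  have std: "s * t * \<delta> = g * E / (f * E')"
    using pos E fg by (simp add: st \<delta>_def field_simps)
  show False
  proof (rule log_gradients_same_sign_impossible[of s t \<delta> "E / D" "E' / D"])
    show "s > 0" "t > 0" "\<delta> > 0" "E / D > 1" "E' / D > \<delta>"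
      using pos E fg by (auto simp: s_def t_def \<delta>_def field_simps)
    show st1: "s \<le> 1" "t \<le> 1"
      using pos P Q fg by (auto simp: s_def t_def field_simps)
    have "s \<noteq> 1 \<or> t \<noteq> 1"
      using pos ne fg by (auto simp: s_def t_def field_simps)
    with st1 show "s + t < 2" by auto
    have "f * (D + E) * (D' * E') = g * (D' + E') * (D * E)"
      using stat pos E by (simp add: field_simps)
    then show "1 + E / D = s * t * (\<delta> + E' / D)"
      using pos E fg by (simp add: st \<delta>_def field_simps)
    have "((f / A - g / A') * A + (f / C - g / C') * C) / f = 2 - s - t"
      using pos E fg by (simp add: s_def t_def field_simps)
    moreover have "(f / E - g / E') * (E - D) / f = (1 - s * t * \<delta>) * (1 - 1 / (E / D))"
      using pos E fg unfolding std by (simp add: field_simps)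
    ultimately show "2 - s - t \<le> (1 - s * t * \<delta>) * (1 - 1 / (E / D))"
      using divide_right_mono[OF first, of f] fg by simp
    have sn: "s \<noteq> 0" "t \<noteq> 0" using pos E fg by (auto simp: s_def t_def)
    have "((f / A - g / A') * A' + (f / C - g / C') * C') / g = 1 / s + 1 / t - 2"
      using pos E fg by (simp add: s_def t_def field_simps)
    then have a: "((f / A - g / A') * A' + (f / C - g / C') * C') / g * (s * t) = s + t - 2 * (s * t)"
      using sn by (simp add: field_simps)
    have "(f / E - g / E') * (E' - D') / g * (s * t)
        = (f * E' / (g * E) * (s * t) - s * t) * (1 - \<delta> / (E' / D))"
      using pos E fg unfolding \<delta>_def by (simp add: field_simps)
    also have "f * E' / (g * E) * (s * t) = 1 / \<delta>"
      using pos E fg by (simp add: st \<delta>_def)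
    finally have b: "(f / E - g / E') * (E' - D') / g * (s * t)
        = (1 / \<delta> - s * t) * (1 - \<delta> / (E' / D))" .
    have "0 < s * t" using pos E fg by (simp add: s_def t_def)
    then show "s + t - 2 * (s * t) \<ge> (1 / \<delta> - s * t) * (1 - \<delta> / (E' / D))"
      using mult_right_mono[OF divide_right_mono[OF second, of g], of "s * t"] fg
      unfolding a b by simp
  qed
qed

text \<open>
  Here \<open>k\<close> and \<open>e\<close> are the logarithmic derivatives of the two denominators \<open>D\<close> and \<open>B + D\<close> along a
  move that adds load at rate \<open>1\<close> and slack at rate \<open>\<kappa>\<close>. With \<open>m = 1/B + a\<close> and \<open>r = 1/B - b\<close>,
  the difference \<open>k * e - m * r\<close> is \<open>a * b\<close> plus a nonnegative multiple of a square.
\<close>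

lemma numerator_le_denominator_rates:
  fixes m r k e B D \<kappa> :: real
  assumes "B > 0" "D > 0" "m \<ge> 1 / B" "r \<le> 1 / B"
    and k: "k = \<kappa> / D" and e: "e = (1 + \<kappa>) / (B + D)" and sum: "m + r = k + e"
  shows "m * r \<le> k * e" and "m * r = k * e \<Longrightarrow> m = 1 / B \<and> r = 1 / B"
proof -
  define h where "h = 1 / B"
  define c where "c = D / B"
  define y where "y = k - e"
  have c: "c > 0" using assms by (simp add: c_def)
  have "(B + D) * e = 1 + D * k" using assms by (simp add: k e)
  then have e': "e = h + y * c" using assms by (simp add: h_def c_def y_def field_simps)
  then have k': "k = h + y * (1 + c)" by (simp add: y_def algebra_simps)
  have y: "m - h + (r - h) = y * (1 + 2 * c)" using sum e' k' by (simp add: algebra_simps)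
  have "m * r = h * (m + r) - h * h - (m - h) * (h - r)" by (simp add: algebra_simps)
  moreover have "k * e = h * (k + e) - h * h + y\<^sup>2 * (c * (1 + c))"
    unfolding e' k' by (simp add: algebra_simps power2_eq_square)
  ultimately have diff: "k * e - m * r = (m - h) * (h - r) + y\<^sup>2 * (c * (1 + c))"
    using sum by simp
  have 1: "(m - h) * (h - r) \<ge> 0" using assms by (simp add: h_def)
  have 2: "y\<^sup>2 * (c * (1 + c)) \<ge> 0" using c by simp
  show "m * r \<le> k * e" using 1 2 diff by simp
  assume "m * r = k * e"
  \<comment> \<open>Equality kills the square, hence \<open>y = 0\<close>; then \<open>m - h\<close>
    and \<open>h - r\<close> agree and have product zero.\<close>
  with 1 2 diff have *: "(m - h) * (h - r) = 0" "y\<^sup>2 * (c * (1 + c)) = 0" by linarith+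
  then have "y = 0" using c by simp
  with * y show "m = 1 / B \<and> r = 1 / B" by (auto simp: h_def)
qed

text \<open>Equal linear coefficients cancel, so denominator minus numerator is
  \<open>(k * e - m * r) * t\<^sup>2\<close>.\<close>

lemma quadratic_ratio_le_one:
  fixes m r k e t :: real
  assumes "m + r = k + e" "1 + k * t > 0" "1 + e * t > 0"
  shows "m * r \<le> k * e \<Longrightarrow> (1 + m * t) * (1 + r * t) / ((1 + k * t) * (1 + e * t)) \<le> 1"
    and "m * r < k * e \<Longrightarrow> t \<noteq> 0 \<Longrightarrow>
      (1 + m * t) * (1 + r * t) / ((1 + k * t) * (1 + e * t)) < 1"
proof -
  have "(1 + k * t) * (1 + e * t) - (1 + m * t) * (1 + r * t)
      = (k + e - (m + r)) * t + (k * e - m * r) * t\<^sup>2"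
    by (simp add: algebra_simps power2_eq_square)
  then have *: "(1 + k * t) * (1 + e * t) - (1 + m * t) * (1 + r * t) = (k * e - m * r) * t\<^sup>2"
    using assms by simp
  have den: "(1 + k * t) * (1 + e * t) > 0" using assms by simp
  {
    assume "m * r \<le> k * e"
    then have "(k * e - m * r) * t\<^sup>2 \<ge> 0" by simp
    with * den show "(1 + m * t) * (1 + r * t) / ((1 + k * t) * (1 + e * t)) \<le> 1" by simp
  next
    assume "m * r < k * e" "t \<noteq> 0"
    then have "(k * e - m * r) * t\<^sup>2 > 0" by simp
    with * den show "(1 + m * t) * (1 + r * t) / ((1 + k * t) * (1 + e * t)) < 1" by simp
  }
qed

lemma ratio_factor:
  fixes A C D E p q g h t :: real
  assumes "A > 0" "C > 0" "D > 0" "E > 0"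
  shows "(A + t * p) * (C + t * q) / ((D + t * g) * (E + t * h)) =
    A * C / (D * E) * ((1 + p / A * t) * (1 + q / C * t) / ((1 + g / D * t) * (1 + h / E * t)))"
proof -
  have "A + t * p = A * (1 + p / A * t)" "C + t * q = C * (1 + q / C * t)"
    "D + t * g = D * (1 + g / D * t)" "E + t * h = E * (1 + h / E * t)"
    using assms by (auto simp: field_simps)
  then show ?thesis by (simp add: mult_ac)
qed

section \<open>The partition problem in terms of loads and slacks\<close>

text \<open>\<open>v_pos\<close> is not given in the problem; it will follow from the positive mean
  service times. As \<open>mu\<close> decreases, indices are ordered like the means, so
  \<open>v_mu_mono\<close> expresses the moment hypothesis.\<close>

locale customer_types =
  fixes n :: nat and lam mu v :: "nat \<Rightarrow> real"
  assumes lam_pos: "i \<in> {1..n} \<Longrightarrow> 0 < lam i"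
    and mu_pos: "i \<in> {1..n} \<Longrightarrow> 0 < mu i"
    and v_pos: "i \<in> {1..n} \<Longrightarrow> 0 < v i"
    and mu_decreasing: "i \<in> {1..n} \<Longrightarrow> j \<in> {1..n} \<Longrightarrow> i < j \<Longrightarrow> mu j < mu i"
    and v_mu_mono: "i \<in> {1..n} \<Longrightarrow> j \<in> {1..n} \<Longrightarrow> i < j \<Longrightarrow> v i * mu i \<le> v j * mu j"
    and stable: "(\<Sum>i=1..n. lam i / mu i) < 1"
begin

definition total :: "(nat \<Rightarrow> real) \<Rightarrow> (nat \<Rightarrow> real) \<Rightarrow> real" where
  "total c x = (\<Sum>i=1..n. lam i * x i * c i)"

abbreviation rate :: "(nat \<Rightarrow> real) \<Rightarrow> real" where "rate \<equiv> total (\<lambda>_. 1)"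
abbreviation load :: "(nat \<Rightarrow> real) \<Rightarrow> real" where "load \<equiv> total (\<lambda>i. 1 / mu i)"
abbreviation work :: "(nat \<Rightarrow> real) \<Rightarrow> real" where "work \<equiv> total v"
abbreviation compl :: "(nat \<Rightarrow> real) \<Rightarrow> nat \<Rightarrow> real" where "compl x \<equiv> \<lambda>i. 1 - x i"
abbreviation ones :: "nat \<Rightarrow> real" where "ones \<equiv> \<lambda>_. 1"

definition slack :: real where "slack = 1 - load ones"

definition box :: "(nat \<Rightarrow> real) \<Rightarrow> bool" where
  "box x \<longleftrightarrow> (\<forall>i\<in>{1..n}. 0 \<le> x i \<and> x i \<le> 1)"

text \<open>One queue's share of the objective without the common factor
  \<open>1 / (2 * rate ones)\<close>; \<open>load x + d\<close> is its capacity.\<close>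

definition cost :: "(nat \<Rightarrow> real) \<Rightarrow> real \<Rightarrow> real" where
  "cost x d = rate x * work x / (d * (load x + d))"

text \<open>
  The first queue is described by its slack \<open>d = a - load x\<close> instead of its capacity \<open>a\<close>: the
  slacks of the two queues add up to the constant \<^term>\<open>slack\<close>, so that the constraints on \<open>x\<close> and
  \<open>d\<close> separate.
\<close>

definition split_opt :: "(nat \<Rightarrow> real) \<Rightarrow> real \<Rightarrow> bool" where
  "split_opt x d \<longleftrightarrow> box x \<and> 0 < d \<and> d < slack \<and>
     (\<forall>y e. box y \<longrightarrow> 0 < e \<longrightarrow> e < slack \<longrightarrow>
        cost x d + cost (compl x) (slack - d) \<le> cost y e + cost (compl y) (slack - e)) \<and>
     cost x d + cost (compl x) (slack - d) \<le> rate ones * work ones / slack"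

lemma slack_pos: "slack > 0"
  using stable by (simp add: slack_def total_def)

lemma total_compl: "total c (compl x) = total c ones - total c x"
  by (simp add: total_def algebra_simps sum_subtractf)

lemma total_update:
  assumes "i \<in> {1..n}"
  shows "total c (x(i := x i + e)) = total c x + lam i * c i * e"
proof -
  have "total c (x(i := x i + e)) = (\<Sum>j=1..n. lam j * x j * c j + (if j = i then lam i * c i * e else 0))"
    unfolding total_def by (intro sum.cong) (auto simp: algebra_simps)
  also have "\<dots> = total c x + lam i * c i * e"
    using assms by (simp add: sum.distrib total_def)
  finally show ?thesis .
qed

lemma total_nonneg:
  assumes "box x" "\<And>i. i \<in> {1..n} \<Longrightarrow> c i \<ge> 0"
  shows "total c x \<ge> 0"
  unfolding total_def using assms lam_pos
  by (intro sum_nonneg mult_nonneg_nonneg) (auto simp: box_def less_imp_le)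

lemma total_pos:
  assumes "box x" "\<And>i. i \<in> {1..n} \<Longrightarrow> c i > 0" "j \<in> {1..n}" "x j > 0"
  shows "total c x > 0"
  unfolding total_def using assms lam_pos
  by (intro sum_pos2[of _ j] mult_nonneg_nonneg mult_pos_pos) (auto simp: box_def less_imp_le)

lemma total_comb:
  "P * total c x + Q * total c' x - K * total c'' x = total (\<lambda>i. P * c i + Q * c' i - K * c'' i) x"
  by (simp add: total_def sum_distrib_left sum.distrib sum_subtractf algebra_simps)

lemma box_compl: "box x \<Longrightarrow> box (compl x)"
  by (auto simp: box_def)

text \<open>Exchanging the queues is a symmetry; it turns one-sided statements below into their
  counterparts for the other queue.\<close>

lemma split_opt_compl:
  assumes "split_opt x d"
  shows "split_opt (compl x) (slack - d)"
proof -
  have "cost (compl x) (slack - d) + cost x d \<le> cost y e + cost (compl y) (slack - e)"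
    if "box y" "0 < e" "e < slack" for y e
  proof -
    have "cost x d + cost (compl x) (slack - d)
        \<le> cost (compl y) (slack - e) + cost (compl (compl y)) (slack - (slack - e))"
      using assms that box_compl[of y] unfolding split_opt_def
      by (metis diff_gt_0_iff_gt diff_less_eq less_add_same_cancel1)
    then show ?thesis by simp
  qed
  then show ?thesis using assms box_compl[of x] by (auto simp: split_opt_def)
qed

section \<open>First-order conditions\<close>

text \<open>The derivative of a quotient of products in a numerator factor is its value divided by
  that factor; the second queue enters negatively because it loses what the first one gains.\<close>

definition rate_gradient :: "(nat \<Rightarrow> real) \<Rightarrow> real \<Rightarrow> real" where
  "rate_gradient x d = cost x d / rate x - cost (compl x) (slack - d) / rate (compl x)"

definition work_gradient :: "(nat \<Rightarrow> real) \<Rightarrow> real \<Rightarrow> real" where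
  "work_gradient x d = cost x d / work x - cost (compl x) (slack - d) / work (compl x)"

definition load_gradient :: "(nat \<Rightarrow> real) \<Rightarrow> real \<Rightarrow> real" where
  "load_gradient x d = cost x d / (load x + d)
     - cost (compl x) (slack - d) / (load (compl x) + (slack - d))"

text \<open>
  The derivative of the objective when load of type \<open>i\<close> is moved into the first queue while the
  slacks are kept.
\<close>

definition score :: "(nat \<Rightarrow> real) \<Rightarrow> real \<Rightarrow> nat \<Rightarrow> real" where
  "score x d i = rate_gradient x d * mu i + work_gradient x d * (v i * mu i) - load_gradient x d"

lemma score_compl: "score (compl x) (slack - d) i = - score x d i"
  by (simp add: score_def rate_gradient_def work_gradient_def load_gradient_def algebra_simps)

definition both_used :: "(nat \<Rightarrow> real) \<Rightarrow> bool" where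
  "both_used x \<longleftrightarrow> (\<exists>i\<in>{1..n}. x i > 0) \<and> (\<exists>i\<in>{1..n}. x i < 1)"

lemma both_used_compl: "both_used x \<Longrightarrow> both_used (compl x)"
  by (auto simp: both_used_def)

lemma both_used_pos:
  assumes "box x" "both_used x"
  shows "rate x > 0" "load x > 0" "work x > 0"
    "rate (compl x) > 0" "load (compl x) > 0" "work (compl x) > 0"
proof -
  obtain i j where ij: "i \<in> {1..n}" "x i > 0" "j \<in> {1..n}" "compl x j > 0"
    using assms(2) by (auto simp: both_used_def)
  show "rate x > 0" "load x > 0" "work x > 0"
    using ij assms(1) mu_pos v_pos by (auto intro!: total_pos[of _ _ i])
  show "rate (compl x) > 0" "load (compl x) > 0" "work (compl x) > 0"
    using ij(3,4) box_compl[OF assms(1)] mu_pos v_pos by (auto intro!: total_pos[of _ _ j])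
qed

text \<open>Moves are measured in load: changing \<open>x i\<close> by
  \<open>s * (mu i / lam i)\<close> adds load \<open>s\<close>, so the capacity changes by
  \<open>s + w\<close> when the slack changes by \<open>w\<close>.\<close>

lemma split_opt_move:
  assumes opt: "split_opt x d" and i: "i \<in> {1..n}"
    and t: "0 \<le> x i + s * (mu i / lam i)" "x i + s * (mu i / lam i) \<le> 1" "0 < d + w" "d + w < slack"
  shows "cost x d + cost (compl x) (slack - d)
    \<le> (rate x + s * mu i) * (work x + s * (v i * mu i)) / ((d + w) * (load x + d + (s + w)))
      + (rate (compl x) - s * mu i) * (work (compl x) - s * (v i * mu i))
        / ((slack - d - w) * (load (compl x) + (slack - d) - (s + w)))"
proof -
  define y where "y = x(i := x i + s * (mu i / lam i))"
  have nz: "lam i \<noteq> 0" "mu i \<noteq> 0" using lam_pos[OF i] mu_pos[OF i] by auto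
  have tot: "total c y = total c x + s * (c i * mu i)" for c
    using i nz by (simp add: y_def total_update)
  have "box y" using opt t by (auto simp: y_def split_opt_def box_def)
  then have "cost x d + cost (compl x) (slack - d)
      \<le> cost y (d + w) + cost (compl y) (slack - (d + w))"
    using opt t by (auto simp: split_opt_def)
  also have "\<dots> = (rate x + s * mu i) * (work x + s * (v i * mu i)) / ((d + w) * (load x + d + (s + w)))
      + (rate (compl x) - s * mu i) * (work (compl x) - s * (v i * mu i))
        / ((slack - d - w) * (load (compl x) + (slack - d) - (s + w)))"
    unfolding cost_def total_compl tot using nz by (simp add: algebra_simps)
  finally show ?thesis .
qed

text \<open>The four rates are independent, so one formula serves load moves (\<open>g = 0\<close>,
  \<open>h = 1\<close>) and slack moves (\<open>p = q = 0\<close>, \<open>g = h\<close>).\<close>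

lemma objective_derivative:
  assumes "split_opt x d" "both_used x"
  shows "((\<lambda>t. (rate x + t * p) * (work x + t * q) / ((d + t * g) * (load x + d + t * h))
      + (rate (compl x) - t * p) * (work (compl x) - t * q)
        / ((slack - d - t * g) * (load (compl x) + (slack - d) - t * h)))
    has_real_derivative
      rate_gradient x d * p + work_gradient x d * q - load_gradient x d * h
        - (cost x d / d - cost (compl x) (slack - d) / (slack - d)) * g) (at 0)"
proof -
  have x: "box x" "0 < d" "0 < slack - d" using assms by (auto simp: split_opt_def)
  note pos = both_used_pos[OF x(1) assms(2)]
  have E: "0 < load x + d" "0 < load (compl x) + (slack - d)" using pos x by auto
  have 1: "((\<lambda>t. (rate x + t * p) * (work x + t * q) / ((d + t * g) * (load x + d + t * h)))
      has_real_derivative cost x d * (p / rate x + q / work x - g / d - h / (load x + d))) (at 0)"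
    using ratio_derivative[OF pos(1,3) x(2) E(1), of p q g h] by (simp add: cost_def)
  have 2: "((\<lambda>t. (rate (compl x) - t * p) * (work (compl x) - t * q)
        / ((slack - d - t * g) * (load (compl x) + (slack - d) - t * h)))
      has_real_derivative cost (compl x) (slack - d) * (- p / rate (compl x) - q / work (compl x)
        + g / (slack - d) + h / (load (compl x) + (slack - d)))) (at 0)"
    using ratio_derivative[OF pos(4,6) x(3) E(2), of "-p" "-q" "-g" "-h"] by (simp add: cost_def)
  show ?thesis
    by (rule DERIV_cong[OF DERIV_add[OF 1 2]])
      (simp add: rate_gradient_def work_gradient_def load_gradient_def algebra_simps)
qed

lemma score_nonneg:
  assumes opt: "split_opt x d" "both_used x" and i: "i \<in> {1..n}" "x i < 1"
  shows "score x d i \<ge> 0"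
proof -
  have pos: "lam i > 0" "mu i > 0" using i lam_pos mu_pos by auto
  \<comment> \<open>The load of type \<open>i\<close> left in the second queue limits the
    move.\<close>
  define e where "e = (1 - x i) * lam i / mu i"
  have "e > 0" using i pos by (simp add: e_def)
  have xi: "x i \<ge> 0" using opt i by (auto simp: split_opt_def box_def)
  note der = objective_derivative[OF opt, of "mu i" "v i * mu i" 0 1]
  have "rate_gradient x d * mu i + work_gradient x d * (v i * mu i) - load_gradient x d * 1
        - (cost x d / d - cost (compl x) (slack - d) / (slack - d)) * 0 \<ge> 0"
  proof (rule derivative_nonneg_at_right_min[OF der \<open>e > 0\<close>], goal_cases)
    case (1 t)
    have "t * (mu i / lam i) \<ge> 0" using 1 pos by simp
    moreover have "t * (mu i / lam i) \<le> 1 - x i"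
      using 1 pos by (simp add: e_def field_simps)
    ultimately show ?case
      using split_opt_move[OF opt(1) i(1), of t 0] xi opt(1)
      by (simp add: cost_def split_opt_def)
  qed
  then show ?thesis by (simp add: score_def)
qed

lemma score_nonpos:
  assumes "split_opt x d" "both_used x" "i \<in> {1..n}" "x i > 0"
  shows "score x d i \<le> 0"
  using score_nonneg[OF split_opt_compl[OF assms(1)] both_used_compl[OF assms(2)] assms(3)] assms(4)
  by (simp add: score_compl)

lemma slack_stationary:
  assumes opt: "split_opt x d" "both_used x"
  shows "cost x d * (1 / d + 1 / (load x + d)) =
    cost (compl x) (slack - d) * (1 / (slack - d) + 1 / (load (compl x) + (slack - d)))"
proof -
  let ?L = "cost x d * (1 / d + 1 / (load x + d)) -
    cost (compl x) (slack - d) * (1 / (slack - d) + 1 / (load (compl x) + (slack - d)))"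
  \<comment> \<open>\<open>d\<close> is interior, so the slack can move both ways, which gives both
    inequalities.\<close>
  have le: "b * ?L \<le> 0" if b: "b = 1 \<or> b = -1" for b
  proof -
    obtain i where i: "i \<in> {1..n}" using opt(2) by (auto simp: both_used_def)
    have d: "0 < d" "d < slack" "0 \<le> x i" "x i \<le> 1" using opt(1) i by (auto simp: split_opt_def box_def)
    note der = objective_derivative[OF opt, of 0 0 b b]
    have "min d (slack - d) > 0" using d by simp
    have "rate_gradient x d * 0 + work_gradient x d * 0 - load_gradient x d * b
        - (cost x d / d - cost (compl x) (slack - d) / (slack - d)) * b \<ge> 0"
    proof (rule derivative_nonneg_at_right_min[OF der \<open>min d (slack - d) > 0\<close>], goal_cases)
      case (1 t)
      then show ?case
        using split_opt_move[OF opt(1) i, of 0 "t * b"] d b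
        by (auto simp: cost_def)
    qed
    then show ?thesis by (simp add: load_gradient_def algebra_simps)
  qed
  from le[of 1] le[of "-1"] have "?L = 0" by simp
  then show ?thesis by simp
qed

text \<open>Weighting the scores by load cancels \<open>mu i\<close>. The averaged assignment
  \<open>x\<close> may differ from the assignment \<open>y\<close> whose gradients are
  taken.\<close>

lemma score_average:
  "total (\<lambda>i. score y d i / mu i) x
     = rate_gradient y d * rate x + work_gradient y d * work x - load_gradient y d * load x"
proof -
  have "score y d i / mu i
      = rate_gradient y d * 1 + work_gradient y d * v i - load_gradient y d * (1 / mu i)"
    if "i \<in> {1..n}" for i
    using mu_pos[OF that] by (simp add: score_def field_simps)
  then show ?thesis unfolding total_comb by (simp add: total_def)
qed

lemma score_average_nonpos:
  assumes "split_opt x d" "both_used x"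
  shows "total (\<lambda>i. score x d i / mu i) x \<le> 0"
  unfolding total_def
proof (intro sum_nonpos)
  fix i assume i: "i \<in> {1..n}"
  then have "x i \<ge> 0" using assms by (auto simp: split_opt_def box_def)
  then show "lam i * x i * (score x d i / mu i) \<le> 0"
    using score_nonpos[OF assms i] lam_pos[OF i] mu_pos[OF i]
    by (cases "x i = 0") (auto simp: mult_le_0_iff divide_le_0_iff)
qed

section \<open>Signs of the rate and work gradients\<close>

text \<open>The score averages over the two queues supply \<open>first\<close> and
  \<open>second\<close> of \<open>gradients_same_sign_impossible\<close>, where \<open>E - D\<close>
  is the load of the first queue. Two nonpositive gradients reduce to this case by exchanging the
  queues.\<close>

lemma gradients_not_same_sign:
  assumes opt: "split_opt x d" "both_used x"
    and "rate_gradient x d \<ge> 0" "work_gradient x d \<ge> 0"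
  shows "rate_gradient x d = 0 \<and> work_gradient x d = 0"
proof (rule ccontr)
  assume ne: "\<not> ?thesis"
  have x: "box x" "0 < d" "0 < slack - d" using opt by (auto simp: split_opt_def)
  note pos = both_used_pos[OF x(1) opt(2)]
  have first: "rate_gradient x d * rate x + work_gradient x d * work x \<le> load_gradient x d * load x"
    using score_average_nonpos[OF opt] by (simp add: score_average)
  have "total (\<lambda>i. score x d i / mu i) (compl x) = - total (\<lambda>i. score (compl x) (slack - d) i / mu i) (compl x)"
    by (simp add: score_compl total_def sum_negf)
  then have "total (\<lambda>i. score x d i / mu i) (compl x) \<ge> 0"
    using score_average_nonpos[OF split_opt_compl[OF opt(1)] both_used_compl[OF opt(2)]] by simp
  then have second: "load_gradient x d * load (compl x)
      \<le> rate_gradient x d * rate (compl x) + work_gradient x d * work (compl x)"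
    by (simp add: score_average)
  show False
    by (rule gradients_same_sign_impossible[where D = d and D' = "slack - d"
          and E = "load x + d" and E' = "load (compl x) + (slack - d)",
          OF pos(1,3) x(2) pos(4,6) x(3) _ _ cost_def cost_def slack_stationary[OF opt]])
      (use pos assms(3,4) ne first second in
        \<open>auto simp: rate_gradient_def work_gradient_def load_gradient_def\<close>)
qed

lemma gradients_not_both_zero:
  assumes opt: "split_opt x d" "both_used x"
    and P: "rate_gradient x d = 0" and Q: "work_gradient x d = 0"
  shows False
proof -
  have x: "box x" "0 < d" "0 < slack - d" using opt by (auto simp: split_opt_def)
  note pos = both_used_pos[OF x(1) opt(2)]
  let ?f = "cost x d" and ?g = "cost (compl x) (slack - d)"
  let ?E = "load x + d" and ?E' = "load (compl x) + (slack - d)"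
  have E: "?E > 0" "?E' > 0" using pos x by auto
  have fg: "?f > 0" "?g > 0" using pos x E by (auto simp: cost_def)
  obtain i j where ij: "i \<in> {1..n}" "x i > 0" "j \<in> {1..n}" "x j < 1"
    using opt(2) by (auto simp: both_used_def)
  \<comment> \<open>All scores equal \<open>- load_gradient x d\<close>; a type from each queue
    bounds this from both sides.\<close>
  have "load_gradient x d = 0"
    using score_nonpos[OF opt ij(1,2)] score_nonneg[OF opt ij(3,4)] P Q by (simp add: score_def)
  then have K: "?f / ?E = ?g / ?E'" by (simp add: load_gradient_def)
  \<comment> \<open>The three vanishing gradients make rate, work and capacity of the first queue
    \<open>c\<close> times those of the second.\<close>
  define c where "c = ?f / ?g"
  have c: "c > 0" using fg by (simp add: c_def)
  have f: "?f = c * ?g" using fg by (simp add: c_def)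
  have A: "rate x = c * rate (compl x)" and C: "work x = c * work (compl x)"
    using P Q fg pos by (auto simp: rate_gradient_def work_gradient_def c_def field_simps)
  have EE: "?E = c * ?E'" using K fg E unfolding c_def by (simp add: field_simps)
  \<comment> \<open>Inserting these proportions into \<open>cost\<close> and comparing with
    \<open>c * ?g\<close> leaves only the two slacks, which must agree.\<close>
  have "?f = c * rate (compl x) * (c * work (compl x)) / (d * (c * ?E'))"
    unfolding cost_def[of x] A C EE ..
  also have "\<dots> = c * (rate (compl x) * work (compl x)) / (d * ?E')"
    using c by (simp add: mult_ac)
  finally have "c * ?g = c * (rate (compl x) * work (compl x)) / (d * ?E')"
    unfolding f .
  then have "c * (rate (compl x) * work (compl x)) / ((slack - d) * ?E')
      = c * (rate (compl x) * work (compl x)) / (d * ?E')"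
    by (simp only: cost_def times_divide_eq_right)
  then have "(slack - d) * ?E' = d * ?E'"
    unfolding divide_cancel_left using c pos by auto
  then have dd: "slack - d = d" using E(2) by auto
  have "?f * (1 / d) = ?g * (1 / (slack - d))"
    using slack_stationary[OF opt] K by (simp add: algebra_simps)
  then have "?f = ?g" using dd x by simp
  then have c1: "c = 1" using fg by (simp add: c_def)
  have R: "rate ones = 2 * rate x" "work ones = 2 * work x" "load ones = 2 * load x"
    using A C EE dd total_compl[of "\<lambda>_. 1" x] total_compl[of v x] total_compl[of "\<lambda>i. 1 / mu i" x]
    by (auto simp: c1)
  have sl: "slack = 2 * d" using dd by simp
  \<comment> \<open>Each queue has capacity one half, so the split costs
    \<open>4 * (rate x * work x / d)\<close>, twice the single-queue bound in
    \<open>split_opt\<close>.\<close>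
  have E12: "?E = 1 / 2" using R(3) sl by (simp add: slack_def)
  have "?f + ?g = 4 * (rate x * work x / d)"
    using \<open>?f = ?g\<close> unfolding cost_def[of x] E12 by simp
  moreover have "?f + ?g \<le> rate ones * work ones / slack"
    using opt(1) by (simp add: split_opt_def)
  then have "?f + ?g \<le> 2 * (rate x * work x / d)" by (simp add: R sl mult.commute)
  moreover have "rate x * work x / d > 0" using pos x by simp
  ultimately show False by linarith
qed

section \<open>Monotone scores and the threshold\<close>

lemma score_strict_decreasing:
  assumes "rate_gradient x d > 0" "work_gradient x d \<le> 0" "i \<in> {1..n}" "j \<in> {1..n}" "i < j"
  shows "score x d j < score x d i"
proof -
  have "rate_gradient x d * mu j < rate_gradient x d * mu i"
    using assms mu_decreasing by simp
  moreover have "work_gradient x d * (v j * mu j) \<le> work_gradient x d * (v i * mu i)"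
    using assms v_mu_mono by (intro mult_left_mono_neg) auto
  ultimately show ?thesis by (simp add: score_def)
qed

lemma total_le_total:
  assumes "\<And>i. i \<in> {1..n} \<Longrightarrow> x i \<noteq> 0 \<Longrightarrow> c i \<le> c' i" "box x"
  shows "total c x \<le> total c' x"
  unfolding total_def
proof (intro sum_mono)
  fix i assume i: "i \<in> {1..n}"
  show "lam i * x i * c i \<le> lam i * x i * c' i"
    using assms lam_pos[OF i] i
    by (cases "x i = 0") (auto simp: box_def intro!: mult_left_mono)
qed

lemma total_scale: "total (\<lambda>i. b * c i) x = b * total c x"
  by (simp add: total_def sum_distrib_left mult_ac)

lemma no_fractional_type:
  assumes opt: "split_opt x d" "both_used x"
    and P: "rate_gradient x d > 0" and Q: "work_gradient x d < 0"
    and j: "j \<in> {1..n}" "0 < x j" "x j < 1"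
  shows False
proof -
  have x: "box x" "0 < d" "0 < slack - d" using opt by (auto simp: split_opt_def)
  have x': "box (compl x)" using box_compl[OF x(1)] .
  note pos = both_used_pos[OF x(1) opt(2)]
  have jp: "lam j > 0" "mu j > 0" "v j > 0" using j lam_pos mu_pos v_pos by auto
  let ?f = "cost x d" and ?g = "cost (compl x) (slack - d)"
  let ?E = "load x + d" and ?E' = "load (compl x) + (slack - d)"
  let ?r = "v j * mu j"
  have E: "?E > 0" "?E' > 0" using pos x by auto
  have fg: "?f > 0" "?g > 0" using pos x E by (auto simp: cost_def)
  have sj: "score x d j = 0"
    using score_nonneg[OF opt j(1,3)] score_nonpos[OF opt j(1,2)] by simp
  \<comment> \<open>The score vanishes at \<open>j\<close> and strictly decreases, so earlier types
    are wholly in the second queue and later ones wholly in the first.\<close>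
  have lower: "x i = 0" if "i \<in> {1..n}" "i < j" for i
  proof -
    have "score x d i > 0" using score_strict_decreasing[OF P _ that(1) j(1) that(2)] Q sj by simp
    then have "\<not> x i > 0" using score_nonpos[OF opt that(1)] by auto
    moreover have "x i \<ge> 0" using x(1) that by (simp add: box_def)
    ultimately show ?thesis by simp
  qed
  have upper: "x i = 1" if "i \<in> {1..n}" "j < i" for i
  proof -
    have "score x d i < 0" using score_strict_decreasing[OF P _ j(1) that(1) that(2)] Q sj by simp
    then have "\<not> x i < 1" using score_nonneg[OF opt that(1)] by auto
    moreover have "x i \<le> 1" using x(1) that by (simp add: box_def)
    ultimately show ?thesis by simp
  qed
  have mu_le: "1 \<le> mu j * (1 / mu i)" "?r * (1 / mu i) \<le> v i" if "i \<in> {1..n}" "x i \<noteq> 0" for i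
  proof -
    have "\<not> i < j" using lower that by auto
    then have "mu i \<le> mu j" "?r \<le> v i * mu i"
      using mu_decreasing[OF j(1) that(1)] v_mu_mono[OF j(1) that(1)] by (cases "i = j"; force)+
    then show "1 \<le> mu j * (1 / mu i)" "?r * (1 / mu i) \<le> v i"
      using mu_pos[OF that(1)] by (simp_all add: field_simps)
  qed
  have mu_ge: "mu j * (1 / mu i) \<le> 1" "v i \<le> ?r * (1 / mu i)" if "i \<in> {1..n}" "compl x i \<noteq> 0" for i
  proof -
    have "\<not> j < i" using upper that by auto
    then have "mu j \<le> mu i" "v i * mu i \<le> ?r"
      using mu_decreasing[OF that(1) j(1)] v_mu_mono[OF that(1) j(1)] by (cases "i = j"; force)+
    then show "mu j * (1 / mu i) \<le> 1" "v i \<le> ?r * (1 / mu i)"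
      using mu_pos[OF that(1)] by (simp_all add: field_simps)
  qed
  have A: "rate x \<le> mu j * load x" and C: "?r * load x \<le> work x"
    unfolding total_scale[symmetric] by (intro total_le_total x(1) mu_le; assumption)+
  have A': "mu j * load (compl x) \<le> rate (compl x)" and C': "work (compl x) \<le> ?r * load (compl x)"
    unfolding total_scale[symmetric] by (intro total_le_total x' mu_ge; assumption)+

  \<comment> \<open>Logarithmic derivatives of rate and work as load of type \<open>j\<close> enters
    the first queue at rate \<open>1\<close>; primed ones belong to the second queue, up to
    sign.\<close>
  define m r m' r' where "m = mu j / rate x" and "r = ?r / work x"
    and "m' = mu j / rate (compl x)" and "r' = ?r / work (compl x)"
  \<comment> \<open>This slack rate solves \<open>m + r = k + e\<close>: the first-order change of
    the first cost vanishes.\<close>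
  define \<kappa> where "\<kappa> = (m + r - 1 / ?E) / (1 / d + 1 / ?E)"
  define k e k' e' where "k = \<kappa> / d" and "e = (1 + \<kappa>) / ?E"
    and "k' = \<kappa> / (slack - d)" and "e' = (1 + \<kappa>) / ?E'"
  have "1 / d + 1 / ?E > 0" using x E by (intro add_pos_pos) auto
  then have "\<kappa> * (1 / d + 1 / ?E) = m + r - 1 / ?E" by (simp add: \<kappa>_def)
  then have sum: "m + r = k + e"
    by (simp add: k_def e_def algebra_simps add_divide_distrib)
  \<comment> \<open>The zero score and stationarity in the slack make the first-order change of the
    second cost vanish too.\<close>
  have "?f * (m + r - 1 / ?E) = ?g * (m' + r' - 1 / ?E')"
    using sj by (simp add: score_def rate_gradient_def work_gradient_def load_gradient_def
        m_def r_def m'_def r'_def algebra_simps)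
  moreover have "?f * (k + e - 1 / ?E) = ?g * (k' + e' - 1 / ?E')"
    using arg_cong[OF slack_stationary[OF opt], of "\<lambda>z. \<kappa> * z"]
    by (simp add: k_def e_def k'_def e'_def algebra_simps add_divide_distrib)
  ultimately have sum': "m' + r' = k' + e'" using sum fg by simp
  have m: "1 / load x \<le> m" "r \<le> 1 / load x"
    using A C pos by (auto simp: m_def r_def field_simps)
  have m': "1 / load (compl x) \<le> r'" "m' \<le> 1 / load (compl x)"
    using A' C' pos by (auto simp: m'_def r'_def field_simps)
  note N = numerator_le_denominator_rates[OF pos(2) x(2) m k_def e_def sum]
  \<comment> \<open>Rate and work swap roles: in the second queue it is \<open>r'\<close> that is at
    least the reciprocal load.\<close>
  note N' = numerator_le_denominator_rates[OF pos(5) x(3) m' k'_def e'_def, unfolded add.commute[of r'], OF sum']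
  have strict: "m * r < k * e \<or> m' * r' < k' * e'"
  proof (rule ccontr)
    assume "\<not> ?thesis"
    \<comment> \<open>Equality in both queues would make work divided by rate equal to
      \<open>v j\<close> in each, giving both gradients the same sign.\<close>
    then have "m = r" "m' = r'" using N N' by (auto simp: mult.commute)
    then have q: "mu j / rate x * work x = ?r" "mu j / rate (compl x) * work (compl x) = ?r"
      using pos by (auto simp: m_def r_def m'_def r'_def field_simps)
    have "?r * work_gradient x d = mu j * rate_gradient x d"
    proof -
      have "?r * (?f / work x) = mu j * (?f / rate x)"
        using pos by (simp add: q(1)[symmetric])
      moreover have "?r * (?g / work (compl x)) = mu j * (?g / rate (compl x))"
        using pos by (simp add: q(2)[symmetric])
      ultimately show ?thesis by (simp add: rate_gradient_def work_gradient_def right_diff_distrib)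
    qed
    moreover have "?r * work_gradient x d < 0" using jp Q by (simp add: mult_pos_neg)
    moreover have "mu j * rate_gradient x d > 0" using jp P by simp
    ultimately show False by linarith
  qed
  have ev: "\<forall>\<^sub>F t in at_right 0. 0 < b + t * c" if "b > 0" for b c :: real
    by (rule order_tendstoD(1)[OF _ that]) (auto intro!: tendsto_eq_intros)
  \<comment> \<open>The constraints are strict at \<open>t = 0\<close>, so they hold for all small
    \<open>t > 0\<close>.\<close>
  have "\<forall>\<^sub>F t in at_right 0. 0 < x j + t * (mu j / lam j) \<and> 0 < 1 - x j + t * - (mu j / lam j) \<and>
      0 < d + t * \<kappa> \<and> 0 < slack - d + t * - \<kappa> \<and> 0 < 1 + t * k \<and> 0 < 1 + t * e \<and>
      0 < 1 + t * - k' \<and> 0 < 1 + t * - e' \<and> 0 < t"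
    using j(2,3) x by (intro eventually_conj ev eventually_at_right_less) auto
  then obtain t where "0 < x j + t * (mu j / lam j)" "0 < 1 - x j + t * - (mu j / lam j)"
      "0 < d + t * \<kappa>" "0 < slack - d + t * - \<kappa>" "0 < 1 + t * k" "0 < 1 + t * e"
      "0 < 1 + t * - k'" "0 < 1 + t * - e'" "0 < t"
    using eventually_happens'[OF trivial_limit_at_right_real] by blast
  then have t: "0 \<le> x j + t * (mu j / lam j)" "x j + t * (mu j / lam j) \<le> 1"
      "0 < d + t * \<kappa>" "d + t * \<kappa> < slack" "0 < 1 + k * t" "0 < 1 + e * t"
      "0 < 1 + k' * (-t)" "0 < 1 + e' * (-t)" "0 < t"
    by (simp_all add: mult.commute)
  let ?R = "(1 + m * t) * (1 + r * t) / ((1 + k * t) * (1 + e * t))"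
  let ?R' = "(1 + m' * (-t)) * (1 + r' * (-t)) / ((1 + k' * (-t)) * (1 + e' * (-t)))"
  have "?f + ?g \<le> (rate x + t * mu j) * (work x + t * ?r) / ((d + t * \<kappa>) * (?E + t * (1 + \<kappa>)))
      + (rate (compl x) + (-t) * mu j) * (work (compl x) + (-t) * ?r)
        / ((slack - d + (-t) * \<kappa>) * (?E' + (-t) * (1 + \<kappa>)))"
    using split_opt_move[OF opt(1) j(1), of t "t * \<kappa>"] t by (simp add: algebra_simps)
  also have "\<dots> = ?f * ?R + ?g * ?R'"
    unfolding ratio_factor[OF pos(1,3) x(2) E(1)] ratio_factor[OF pos(4,6) x(3) E(2)]
    by (simp add: cost_def m_def r_def m'_def r'_def k_def e_def k'_def e'_def)
  also have "\<dots> < ?f + ?g"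
  proof -
    have "?R \<le> 1" using quadratic_ratio_le_one(1)[OF sum t(5,6) N(1)] .
    moreover have "?R' \<le> 1"
      using quadratic_ratio_le_one(1)[OF sum' t(7,8)] N'(1) by (simp add: mult.commute)
    moreover have "?R < 1 \<or> ?R' < 1"
      using strict quadratic_ratio_le_one(2)[OF sum t(5,6)] quadratic_ratio_le_one(2)[OF sum' t(7,8)]
        t(9) by auto
    moreover have "y * z \<le> y" if "y > 0" "z \<le> 1" for y z :: real using that by simp
    moreover have "y * z < y" if "y > 0" "z < 1" for y z :: real using that by simp
    ultimately show ?thesis using fg by (meson add_le_less_mono add_less_le_mono)
  qed
  finally show False by simp
qed

lemma threshold_of_gradient_signs:
  assumes opt: "split_opt x d" "both_used x"
    and P: "rate_gradient x d > 0" and Q: "work_gradient x d < 0"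
  shows "\<exists>k\<in>{0..n}. \<forall>i\<in>{1..n}. x i = (if i \<le> k then 0 else 1)"
proof -
  have x01: "x i = 0 \<or> x i = 1" if "i \<in> {1..n}" for i
  proof -
    have "0 \<le> x i" "x i \<le> 1" using opt(1) that by (auto simp: split_opt_def box_def)
    then show ?thesis using no_fractional_type[OF opt P Q that] by (metis antisym_conv2)
  qed
  have up: "x j = 1" if "i \<in> {1..n}" "j \<in> {1..n}" "i < j" "x i = 1" for i j
  proof -
    have "score x d j < 0"
      using score_strict_decreasing[OF P _ that(1,2,3)] score_nonpos[OF opt that(1)] Q that by simp
    then have "x j \<noteq> 0" using score_nonneg[OF opt that(2)] by auto
    then show ?thesis using x01[OF that(2)] by simp
  qed
  define Z where "Z = {i \<in> {1..n}. x i = 0}"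
  \<comment> \<open>The inserted \<open>0\<close> is the threshold when \<open>Z\<close> is
    empty.\<close>
  define k where "k = Max (insert 0 Z)"
  have fin: "finite (insert 0 Z)" by (simp add: Z_def)
  have k: "k \<in> insert 0 Z" unfolding k_def using fin by (intro Max_in) auto
  have "x i = (if i \<le> k then 0 else 1)" if i: "i \<in> {1..n}" for i
  proof (cases "i \<le> k")
    case True
    then have "k \<in> Z" using k i by auto
    then show ?thesis using True up[OF i, of k] x01[OF i] by (cases "i = k") (auto simp: Z_def)
  next
    case False
    then have "i \<notin> Z" using Max_ge[OF fin, of i] by (auto simp: k_def)
    then show ?thesis using False x01[OF i] i by (auto simp: Z_def)
  qed
  moreover have "k \<in> {0..n}" using k by (auto simp: Z_def)
  ultimately show ?thesis by blast
qed

lemma threshold_of_split_opt: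
  assumes "split_opt x d"
  shows "\<exists>k\<in>{0..n}. (\<forall>i\<in>{1..n}. x i = (if i \<le> k then 1 else 0))
         \<or> (\<forall>i\<in>{1..n}. x i = (if i \<le> k then 0 else 1))"
proof (cases "both_used x")
  case False
  moreover have "\<forall>i\<in>{1..n}. 0 \<le> x i \<and> x i \<le> 1"
    using assms by (simp add: split_opt_def box_def)
  ultimately have "(\<forall>i\<in>{1..n}. x i = 0) \<or> (\<forall>i\<in>{1..n}. x i = 1)"
    unfolding both_used_def by (meson antisym_conv2 less_eq_real_def not_less)
  \<comment> \<open>With one queue empty, \<open>k = n\<close> fits: the first pattern for all ones,
    the second for all zeros.\<close>
  then show ?thesis by (intro bexI[of _ n]) auto
next
  case True
  let ?x = "compl x" and ?d = "slack - d"
  have swap: "split_opt ?x ?d" "both_used ?x"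
    using assms True split_opt_compl both_used_compl by auto
  have neg: "rate_gradient ?x ?d = - rate_gradient x d" "work_gradient ?x ?d = - work_gradient x d"
    by (auto simp: rate_gradient_def work_gradient_def)
  consider "rate_gradient x d > 0" "work_gradient x d < 0"
    | "rate_gradient x d < 0" "work_gradient x d > 0"
    using gradients_not_same_sign[OF assms True] gradients_not_same_sign[OF swap]
      gradients_not_both_zero[OF assms True] unfolding neg by force
  then show ?thesis
  proof cases
    case 1
    then show ?thesis using threshold_of_gradient_signs[OF assms True] by blast
  next
    case 2
    then obtain k where "k \<in> {0..n}" "\<forall>i\<in>{1..n}. 1 - x i = (if i \<le> k then 0 else 1)"
      using threshold_of_gradient_signs[OF swap] neg by auto
    then show ?thesis by (intro bexI[of _ k]) (auto split: if_splits)
  qed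
qed

section \<open>Return to the original problem\<close>

text \<open>Each denominator factors as capacity times slack, and the second queue has slack
  \<open>slack - (a - load x)\<close>.\<close>

lemma waiting_time_interior:
  assumes "0 < a" "a < 1"
  shows "waiting_time n lam mu v (x, a) =
    (cost x (a - load x) + cost (compl x) (slack - (a - load x))) / (2 * rate ones)"
proof -
  have "load (compl x) + (slack - (a - load x)) = 1 - a"
    by (simp add: total_compl slack_def)
  moreover have "(1 - a)\<^sup>2 - (1 - a) * load (compl x) = (slack - (a - load x)) * (1 - a)"
    by (simp add: total_compl slack_def power2_eq_square algebra_simps)
  moreover have "a\<^sup>2 - a * load x = (a - load x) * a"
    by (simp add: power2_eq_square algebra_simps)
  ultimately show ?thesis
    using assms by (simp add: waiting_time_def cost_def add_divide_distrib)
      (simp add: total_def mult_ac)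
qed

lemma qpp_feasible_interior:
  assumes "box y" "0 < e" "e < slack"
  shows "0 < load y + e" "load y + e < 1" "qpp_feasible n lam mu (y, load y + e)"
proof -
  have ge: "load y \<ge> 0" "load (compl y) \<ge> 0"
    using assms box_compl[of y] mu_pos by (auto intro!: total_nonneg simp: less_imp_le)
  then show *: "0 < load y + e" "load y + e < 1"
    using assms by (auto simp: slack_def total_compl)
  have "load y < load y + e" "load y + e < load y + 1 - load ones"
    using assms by (auto simp: slack_def)
  then show "qpp_feasible n lam mu (y, load y + e)"
    using * assms by (auto simp: qpp_feasible_def stable_set_def total_def box_def)
qed

lemma qpp_feasible_cases:
  assumes "qpp_feasible n lam mu (x, a)"
  obtains "\<forall>i\<in>{1..n}. x i = 0" | "\<forall>i\<in>{1..n}. x i = 1"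
    | "0 < a" "a < 1" "0 < a - load x" "a - load x < slack" "box x"
  using assms by (auto simp: qpp_feasible_def stable_set_def total_def box_def slack_def)

lemma split_opt_of_qpp_optimal:
  assumes opt: "qpp_optimal n lam mu v (x, a)" and "n > 0"
    and x: "0 < a" "a < 1" "0 < a - load x" "a - load x < slack" "box x"
  shows "split_opt x (a - load x)"
proof -
  let ?val = "\<lambda>x d. cost x d + cost (compl x) (slack - d)"
  have "rate ones > 0" using \<open>n > 0\<close> by (intro total_pos[of _ _ 1]) (auto simp: box_def)
  then have R: "2 * rate ones > 0" by simp
  have min: "waiting_time n lam mu v (x, a) \<le> waiting_time n lam mu v p"
    if "qpp_feasible n lam mu p" for p
    using opt that by (cases p) (auto simp: qpp_optimal_def is_arg_min_linorder)
  have "?val x (a - load x) \<le> ?val y e" if "box y" "0 < e" "e < slack" for y e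
    using min[OF qpp_feasible_interior(3)[OF that]] R
    unfolding waiting_time_interior[OF x(1,2)] waiting_time_interior[OF qpp_feasible_interior(1,2)[OF that]]
    by (simp add: divide_right_mono divide_le_cancel)
  moreover have "?val x (a - load x) \<le> rate ones * work ones / slack"
  proof -
    \<comment> \<open>At the feasible point \<open>(0, 0)\<close>, \<open>waiting_time\<close> takes
      its single-queue value.\<close>
    have "qpp_feasible n lam mu (\<lambda>_. 0, 0)" by (auto simp: qpp_feasible_def stable_set_def)
    from min[OF this] have "?val x (a - load x) / (2 * rate ones) \<le> 1 / 2 * (work ones / slack)"
      unfolding waiting_time_interior[OF x(1,2)]
      by (simp add: waiting_time_def total_def slack_def)
    then show ?thesis using R by (simp add: field_simps)
  qed
  ultimately show ?thesis using x by (auto simp: split_opt_def)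
qed

end

theorem theorem3:
  fixes n :: nat
    and lam mu v :: "nat \<Rightarrow> real"
    and M :: "'w measure"
    and S :: "nat \<Rightarrow> 'w \<Rightarrow> real"
    and x :: "nat \<Rightarrow> real"
    and a :: real
  assumes "prob_space M"
    and "\<And>i. i \<in> {1..n} \<Longrightarrow> S i \<in> borel_measurable M"
    and "\<And>i. i \<in> {1..n} \<Longrightarrow> AE \<omega> in M. 0 \<le> S i \<omega>"
    and "\<And>i. i \<in> {1..n} \<Longrightarrow> integrable M (\<lambda>\<omega>. (S i \<omega>)\<^sup>2)"
    and "\<And>i. i \<in> {1..n} \<Longrightarrow> prob_space.expectation M (S i) = 1 / mu i"
    and "\<And>i. i \<in> {1..n} \<Longrightarrow> prob_space.expectation M (\<lambda>\<omega>. (S i \<omega>)\<^sup>2) = v i"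
    and "\<And>i. i \<in> {1..n} \<Longrightarrow> 0 < lam i"
    and "\<And>i. i \<in> {1..n} \<Longrightarrow> 0 < mu i"
    and "\<And>i j. i \<in> {1..n} \<Longrightarrow> j \<in> {1..n} \<Longrightarrow> i < j \<Longrightarrow> mu j < mu i"
    and "(\<Sum>i=1..n. lam i / mu i) < 1"
    and "\<And>i j. i \<in> {1..n} \<Longrightarrow> j \<in> {1..n} \<Longrightarrow>
           prob_space.expectation M (S i) \<ge> prob_space.expectation M (S j) \<Longrightarrow>
           prob_space.expectation M (\<lambda>\<omega>. (S i \<omega>)\<^sup>2) / prob_space.expectation M (S i)
             \<ge> prob_space.expectation M (\<lambda>\<omega>. (S j \<omega>)\<^sup>2) / prob_space.expectation M (S j)"
    and "qpp_optimal n lam mu v (x, a)"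
  shows "\<exists>k\<in>{0..n}.
           (\<forall>i\<in>{1..n}. x i = (if i \<le> k then 1 else 0))
         \<or> (\<forall>i\<in>{1..n}. x i = (if i \<le> k then 0 else 1))"
proof -
  \<comment> \<open>A vanishing second moment would make the service time zero almost everywhere,
    against its mean \<open>1 / mu i\<close>.\<close>
  have v: "0 < v i" if i: "i \<in> {1..n}" for i
  proof (rule ccontr)
    assume "\<not> 0 < v i"
    moreover have "0 \<le> v i" unfolding assms(6)[OF i, symmetric] by simp
    ultimately have "(\<integral>\<omega>. (S i \<omega>)\<^sup>2 \<partial>M) = 0" using assms(6)[OF i] by simp
    then have "AE \<omega> in M. S i \<omega> = 0"
      using integral_nonneg_eq_0_iff_AE[OF assms(4)[OF i]] by simp
    then have "(\<integral>\<omega>. S i \<omega> \<partial>M) = 0" by (rule integral_eq_zero_AE)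
    then show False using assms(5,8)[OF i] by simp
  qed
  interpret customer_types n lam mu v
  proof
    fix i j assume ij: "i \<in> {1..n}" "j \<in> {1..n}" "i < j"
    have "1 / mu i \<le> 1 / mu j"
      using assms(8)[OF ij(2)] assms(9)[OF ij] by (intro divide_left_mono) auto
    then show "v i * mu i \<le> v j * mu j"
      using assms(11)[OF ij(2,1)] assms(5,6)[OF ij(1)] assms(5,6)[OF ij(2)] by simp
  qed (fact assms(7) assms(8) v assms(9) assms(10))+
  have "qpp_feasible n lam mu (x, a)" using assms(12) by (simp add: qpp_optimal_def is_arg_min_def)
  then show ?thesis
  proof (cases rule: qpp_feasible_cases)
    case 3
    show ?thesis
    \<comment> \<open>Clearing the factor \<open>2 * rate ones\<close> requires a type; for
      \<open>n = 0\<close> the claim is vacuous.\<close>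
    proof (cases "n = 0")
      case False
      then show ?thesis using threshold_of_split_opt split_opt_of_qpp_optimal[OF assms(12) _ 3] by simp
    qed simp
  \<comment> \<open>Constant assignments are thresholds with \<open>k = n\<close>.\<close>
  qed (intro bexI[of _ n]; simp)+
qed

end
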